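(* For $n\geq1$, $$\sum_{\pi\in RS_n}s^{\mathrm{iasc}(\pi)}t^{\mathrm{asc}(\pi)}=\sum_{e\in\mathbf{I}_n(000)}s^{\mathrm{asc}(e)}t^{\mathrm{dist}(e)}.$$
   Context: A permutation $\pi$ of $\{1,\ldots,n\}$ is a Simsun permutation if for every $k\in\{1,\ldots,n\}$ the word obtained from $\pi$ by deleting the values $k+1,\ldots,n$ has no three consecutive letters $w_{i-1}>w_i>w_{i+1}$; $RS_n$ is the set of Simsun permutations of $\{1,\ldots,n\}$. For a permutation, $\mathrm{asc}(\pi)=n-1-\mathrm{des}(\pi)$ with $\mathrm{des}(\pi)=|\{i\in[n-1]:\pi_i>\pi_{i+1}\}|$, and $\mathrm{iasc}(\pi)=\mathrm{asc}(\pi^{-1})$. $\mathbf{I}_n=\{(e_1,\ldots,e_n): 0\leq e_i<i\}$; $\mathbf{I}_n(000)$ is the set of $e\in\mathbf{I}_n$ with no $i<j<k$ such that $e_i=e_j=e_k$. For $e\in\mathbf{I}_n$, $\mathrm{asc}(e)=|\{i\in[n-1]:e_i<e_{i+1}\}|$ and $\mathrm{dist}(e)$ is the number of distinct positive values among its entries. *)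

theory Defs
  imports "HOL-Combinatorics.Permutations" "HOL-Library.FuncSet"
begin

definition perm_word :: "nat \<Rightarrow> (nat \<Rightarrow> nat) \<Rightarrow> nat list" where
  "perm_word n \<pi> = map \<pi> [1..<Suc n]"

definition no_double_descent :: "nat list \<Rightarrow> bool" where
  "no_double_descent w \<longleftrightarrow>
     \<not> (\<exists>i. i + 2 < length w \<and> w ! i > w ! (i + 1) \<and> w ! (i + 1) > w ! (i + 2))"

definition RS :: "nat \<Rightarrow> (nat \<Rightarrow> nat) set" where
  "RS n = {\<pi>. \<pi> permutes {1..n} \<and>
     (\<forall>k\<in>{1..n}. no_double_descent (filter (\<lambda>v. v \<notin> {k+1..n}) (perm_word n \<pi>)))}"

definition perm_des :: "nat \<Rightarrow> (nat \<Rightarrow> nat) \<Rightarrow> nat" where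
  "perm_des n \<pi> = card {i \<in> {1..n-1}. \<pi> i > \<pi> (i + 1)}"

text \<open>The truncated subtraction is harmless: \<open>perm_des n \<pi> \<le> n - 1\<close> always.\<close>

definition perm_asc :: "nat \<Rightarrow> (nat \<Rightarrow> nat) \<Rightarrow> nat" where
  "perm_asc n \<pi> = n - 1 - perm_des n \<pi>"

definition perm_iasc :: "nat \<Rightarrow> (nat \<Rightarrow> nat) \<Rightarrow> nat" where
  "perm_iasc n \<pi> = perm_asc n (inv \<pi>)"

text \<open>Inversion sequences \<open>(e\<^sub>1, \<dots>, e\<^sub>n)\<close> are functions on \<open>{1..n}\<close>, taken extensional so
  that distinct functions are distinct sequences.\<close>

definition inv_seqs :: "nat \<Rightarrow> (nat \<Rightarrow> nat) set" where
  "inv_seqs n = (\<Pi>\<^sub>E i\<in>{1..n}. {0..<i})"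

definition inv_seqs_000 :: "nat \<Rightarrow> (nat \<Rightarrow> nat) set" where
  "inv_seqs_000 n = {e \<in> inv_seqs n.
     \<not> (\<exists>i\<in>{1..n}. \<exists>j\<in>{1..n}. \<exists>k\<in>{1..n}. i < j \<and> j < k \<and> e i = e j \<and> e j = e k)}"

definition seq_asc :: "nat \<Rightarrow> (nat \<Rightarrow> nat) \<Rightarrow> nat" where
  "seq_asc n e = card {i \<in> {1..n-1}. e i < e (i + 1)}"

definition seq_dist :: "nat \<Rightarrow> (nat \<Rightarrow> nat) \<Rightarrow> nat" where
  "seq_dist n e = card {v \<in> e ` {1..n}. v > 0}"

lemma finite_RS: "finite (RS n)"
  by (rule finite_subset[OF _ finite_permutations[of "{1..n}"]]) (auto simp: RS_def)

lemma finite_inv_seqs_000: "finite (inv_seqs_000 n)"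
  by (rule finite_subset[of _ "inv_seqs n"])
    (auto simp: inv_seqs_000_def inv_seqs_def intro: finite_PiE)

end

theory Submission
  imports Defs
begin

text \<open>
  Both families grow one letter at a time, by a choice from a word over two kinds of letters that
  carries a mark. For a 000-avoiding inversion sequence the letters are the values that may be
  appended, in increasing order: \<open>True\<close> for an unused value, \<open>False\<close> for a value used once, with the
  mark just after the last entry. For a Simsun permutation they are the gaps in which the next
  maximum may be inserted, from left to right: \<open>True\<close> for a gap that raises the number of ascents,
  \<open>False\<close> for one that does not, with the mark at the current maximum. In both cases a chosen
  \<open>True\<close> turns into \<open>False\<close> and a chosen \<open>False\<close> disappears, the mark moves to the chosen place, and
  one new \<open>True\<close> appears to the right of the mark; the choice counts for \<open>t\<close> if it is \<open>True\<close> and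
  for \<open>s\<close> if it is to the right of the old mark. The only difference is that the new \<open>True\<close> comes at
  the far right for sequences and directly after the mark for permutations. This is irrelevant
  because the generating function of all continuations does not depend on the order of the letters
  on either side of the mark.
\<close>

section \<open>Growth of marked words\<close>

text \<open>A sum over the positions of the second list. The recursion moves each passed letter to
  the end of the first list, so \<open>f\<close> sees the full context of the chosen letter on both
  sides.\<close>

fun picks :: "('b list \<Rightarrow> 'b \<Rightarrow> 'b list \<Rightarrow> 'a::comm_monoid_add) \<Rightarrow> 'b list \<Rightarrow> 'b list \<Rightarrow> 'a"
  where
  "picks f a [] = 0"
| "picks f a (x # b) = f a x b + picks f (a @ [x]) b"

lemma picks_append:
  "picks f a (u @ v) = picks (\<lambda>a x b. f a x (b @ v)) a u + picks f (a @ u) v"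
  by (induction u arbitrary: a) (auto simp: add.assoc)

text \<open>Exposes a fixed prefix of the accumulated context inside \<open>f\<close>, where a fact
  about \<open>f\<close> can then rewrite it.\<close>

lemma picks_prefix: "picks f (p @ a) b = picks (\<lambda>a. f (p @ a)) a b"
proof (induction b arbitrary: a)
  case (Cons x b)
  show ?case using Cons[of "a @ [x]"] by simp
qed simp

definition spent :: "bool \<Rightarrow> bool list" where
  "spent x = (if x then [False] else [])"

context
  fixes s t :: "'a::comm_semiring_1"
begin

definition pick_weight :: "bool \<Rightarrow> 'a" where
  "pick_weight x = (if x then t else 1)"

primrec growth :: "nat \<Rightarrow> bool list \<Rightarrow> bool list \<Rightarrow> 'a" where
  "growth 0 L R = 1"
| "growth (Suc k) L R =
     picks (\<lambda>a x b. pick_weight x * growth k (a @ spent x) (b @ R @ [True])) [] L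
     + s * picks (\<lambda>a x b. pick_weight x * growth k (a @ spent x) (b @ [True])) L R"

text \<open>Moving one letter across the mark changes only the weight of choosing that letter.\<close>

lemma growth_exchange:
  "t * growth k (A @ [False]) (False # B) + growth k (A @ [True]) B
   = growth k A (True # B) + t * growth k (A @ [False, False]) B"
proof (cases k)
  case 0
  then show ?thesis by (simp add: add.commute)
next
  case (Suc j)
  have "growth k (A @ [False, False]) B = growth k ((A @ [False]) @ [False]) B"
    by simp
  \<comment> \<open>Choosing the moved letter leads to
    \<open>growth j (A @ [False]) (B @ [True])\<close> in all four terms, with total weight
    \<open>t + s * t\<close> on each side. The other choices of the first term match those of the
    fourth, and those of the second match the third.\<close>
  then show ?thesis
    unfolding Suc growth.simps picks_append
    by (simp add: pick_weight_def spent_def picks_append algebra_simps)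
qed

text \<open>A choice outside the pair leaves a swapped pair on one side of the mark, possibly the
  other side, so both claims go through one induction. For a pair of different letters, the two
  choices inside it balance by \<open>growth_exchange\<close>.\<close>

lemma growth_swap:
  "growth k L (a @ x # y # b) = growth k L (a @ y # x # b)"
  "growth k (a @ x # y # b) R = growth k (a @ y # x # b) R"
proof (induction k arbitrary: L a x y b R)
  case (Suc k)
  note right = Suc(1) and left = Suc(2)
  have right': "growth k L (c @ a @ x # y # b) = growth k L (c @ a @ y # x # b)" for L c a x y b
    using right[of L "c @ a"] by simp
  have suffix: "picks (\<lambda>a x b. pick_weight x * growth k (a @ spent x) (b @ R)) (p @ x # y # q) u =
      picks (\<lambda>a x b. pick_weight x * growth k (a @ spent x) (b @ R)) (p @ y # x # q) u"
    (is "picks ?f _ _ = _")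
    for p x y q u R
    using picks_prefix[of ?f "p @ x # y # q" "[]" u] picks_prefix[of ?f "p @ y # x # q" "[]" u]
    by (simp only: append_Nil2 append_assoc append_Cons left)
  \<comment> \<open>The exchange identity in the right-nested shape of a longer sum;
    \<open>z\<close> stands for the summands that follow.\<close>
  have exchange: "t * growth k (A @ [False]) (False # B) + (growth k (A @ [True]) B + z)
      = growth k A (True # B) + (t * growth k (A @ [False, False]) B + z)" for A B z
    using growth_exchange[of k A B] by (simp flip: add.assoc)
  have TF: "growth (Suc k) L (a @ True # False # b) = growth (Suc k) L (a @ False # True # b)"
    for L a b
    using exchange[of "L @ a" "b @ [True]"] suffix[of "[True]" "L @ a" True False "[]" b]
    by (simp add: picks_append right right' add.assoc pick_weight_def spent_def)
  have TF': "growth (Suc k) (a @ True # False # b) R = growth (Suc k) (a @ False # True # b) R"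
    for a b R
    using exchange[of a "b @ R @ [True]"]
      suffix[of "R @ [True]" a True False "[]" b] suffix[of "[True]" a True False b R]
    by (simp add: picks_append right right' add.assoc pick_weight_def spent_def)
  {
    case 1
    show ?case using TF by (cases x; cases y) auto
  next
    case 2
    show ?case using TF' by (cases x; cases y) auto
  }
qed simp_all

text \<open>Reconciles the two places at which the new \<open>True\<close> appears; repeated swaps
  carry the letter to the end.\<close>

lemma growth_rotate: "growth k L (a @ x # b) = growth k L (a @ b @ [x])"
proof (induction b arbitrary: a)
  case (Cons y b)
  show ?case using Cons[of "a @ [y]"] growth_swap(1)[of k L a x y b] by simp
qed simp

end

section \<open>Inversion sequences\<close>

lemma picks_map_filter_upt:
  assumes "lo \<le> hi"
  shows "picks f c (map g (filter P [lo..<hi])) =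
    (\<Sum>v\<in>{v\<in>{lo..<hi}. P v}. f (c @ map g (filter P [lo..<v])) (g v) (map g (filter P [Suc v..<hi])))"
  using assms
proof (induction hi arbitrary: f rule: dec_induct)
  case (step hi)
  have "{v\<in>{lo..<Suc hi}. P v} = {v\<in>{lo..<hi}. P v} \<union> (if P hi then {hi} else {})"
    using step(1) by (auto simp: less_Suc_eq)
  moreover have "(\<Sum>v\<in>{v\<in>{lo..<hi}. P v}. f (c @ map g (filter P [lo..<v])) (g v)
        (map g (filter P [Suc v..<Suc hi]))) =
      (\<Sum>v\<in>{v\<in>{lo..<hi}. P v}. f (c @ map g (filter P [lo..<v])) (g v)
        (map g (filter P [Suc v..<hi]) @ map g (filter P [hi])))"
    by (rule sum.cong) auto
  ultimately show ?case
    using step by (simp add: picks_append add.commute)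
qed simp

definition usable :: "nat \<Rightarrow> (nat \<Rightarrow> nat) \<Rightarrow> nat \<Rightarrow> bool" where
  "usable m e v \<longleftrightarrow> \<not> (\<exists>i\<in>{1..m}. \<exists>j\<in>{1..m}. i < j \<and> e i = v \<and> e j = v)"

text \<open>The bounds \<open>lo\<close> and \<open>hi\<close> allow the word to be cut at the mark,
  that is, just above the last entry.\<close>

definition value_word :: "nat \<Rightarrow> (nat \<Rightarrow> nat) \<Rightarrow> nat \<Rightarrow> nat \<Rightarrow> bool list" where
  "value_word m e lo hi = map (\<lambda>v. v \<notin> e ` {1..m}) (filter (usable m e) [lo..<hi])"

lemma value_word_append:
  "lo \<le> mid \<Longrightarrow> mid \<le> hi \<Longrightarrow> value_word m e lo mid @ value_word m e mid hi = value_word m e lo hi"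
  unfolding value_word_def
  by (metis filter_append le_Suc_ex map_append upt_add_eq_append)

lemma picks_value_word:
  "lo \<le> hi \<Longrightarrow> picks f c (value_word m e lo hi) =
    (\<Sum>v\<in>{v\<in>{lo..<hi}. usable m e v}.
      f (c @ value_word m e lo v) (v \<notin> e ` {1..m}) (value_word m e (Suc v) hi))"
  unfolding value_word_def by (rule picks_map_filter_upt)

text \<open>Deleting the last entry keeps avoidance, and an appended value completes a forbidden
  triple only if it already occurs twice.\<close>

lemma inv_seqs_000_Suc:
  "bij_betw (\<lambda>(e, v). e(Suc m := v))
     (SIGMA e:inv_seqs_000 m. {v\<in>{0..<Suc m}. usable m e v}) (inv_seqs_000 (Suc m))"
\<comment> \<open>The inverse puts \<open>undefined\<close> back at \<open>Suc m\<close>, as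
  extensionality on \<open>{1..m}\<close> requires.\<close>
proof (rule bij_betwI[where g = "\<lambda>e. (e(Suc m := undefined), e (Suc m))"], goal_cases)
  case 1
  have I: "{1..Suc m} = insert (Suc m) {1..m}" by auto
  show ?case
  proof (intro Pi_I)
    fix p assume "p \<in> (SIGMA e:inv_seqs_000 m. {v\<in>{0..<Suc m}. usable m e v})"
    then obtain e v where p: "p = (e, v)" and e: "e \<in> inv_seqs_000 m"
      and v: "v < Suc m" "usable m e v" by auto
    have "e(Suc m := v) \<in> inv_seqs (Suc m)"
      using e v unfolding inv_seqs_000_def inv_seqs_def I
      by (auto simp: PiE_iff extensional_def)
    moreover have False if "i \<in> {1..Suc m}" "j \<in> {1..Suc m}" "k \<in> {1..Suc m}" "i < j" "j < k"
      "(e(Suc m := v)) i = (e(Suc m := v)) j" "(e(Suc m := v)) j = (e(Suc m := v)) k" for i j k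
    proof (cases "k = Suc m")
      case True
      then have "i \<in> {1..m}" "j \<in> {1..m}" "e i = v" "e j = v" using that by auto
      then show False using v(2) \<open>i < j\<close> unfolding usable_def by blast
    next
      case False
      then have "i \<in> {1..m}" "j \<in> {1..m}" "k \<in> {1..m}" "e i = e j" "e j = e k"
        using that by auto
      then show False using e \<open>i < j\<close> \<open>j < k\<close> unfolding inv_seqs_000_def by blast
    qed
    ultimately show "(case p of (e, v) \<Rightarrow> e(Suc m := v)) \<in> inv_seqs_000 (Suc m)"
      unfolding inv_seqs_000_def p case_prod_conv mem_Collect_eq by blast
  qed
next
  case 2
  have I: "{1..Suc m} = insert (Suc m) {1..m}" by auto
  show ?case
  proof (intro Pi_I SigmaI)
    fix e assume e: "e \<in> inv_seqs_000 (Suc m)"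
    then have "e(Suc m := undefined) \<in> inv_seqs m"
      unfolding inv_seqs_000_def inv_seqs_def I by (auto simp: PiE_iff extensional_def)
    moreover have False if ijk: "i \<in> {1..m}" "j \<in> {1..m}" "k \<in> {1..m}" "i < j" "j < k"
      and eq: "(e(Suc m := undefined)) i = (e(Suc m := undefined)) j"
        "(e(Suc m := undefined)) j = (e(Suc m := undefined)) k" for i j k
    proof -
      have "e i = e j" "e j = e k" using ijk eq by auto
      then show False using e ijk unfolding inv_seqs_000_def I by blast
    qed
    ultimately show "e(Suc m := undefined) \<in> inv_seqs_000 m"
      unfolding inv_seqs_000_def mem_Collect_eq by blast
    have "e (Suc m) < Suc m"
      using e unfolding inv_seqs_000_def inv_seqs_def I by (auto simp: PiE_iff)
    moreover have "usable m (e(Suc m := undefined)) (e (Suc m))"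
      unfolding usable_def
    proof (intro notI, elim bexE conjE)
      fix i j assume ij: "i \<in> {1..m}" "j \<in> {1..m}" "i < j"
        and "(e(Suc m := undefined)) i = e (Suc m)" "(e(Suc m := undefined)) j = e (Suc m)"
      then have "e i = e j" "e j = e (Suc m)" "j < Suc m" by auto
      then show False using e ij unfolding inv_seqs_000_def I by blast
    qed
    ultimately show "e (Suc m) \<in> {v\<in>{0..<Suc m}. usable m (e(Suc m := undefined)) v}"
      by simp
  qed
next
  case (3 p)
  then show ?case
    by (auto simp: inv_seqs_000_def inv_seqs_def PiE_iff extensional_def fun_eq_iff)
qed auto

text \<open>The growth rule for sequences. Only \<open>v\<close> changes its status, and
  \<open>Suc m\<close> enters as a new value: every earlier entry is smaller than its index, so it
  cannot have occurred.\<close>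

lemma value_word_extend:
  assumes e: "e \<in> inv_seqs_000 m" and v: "v < Suc m" "usable m e v"
  shows "value_word (Suc m) (e(Suc m := v)) 0 (Suc v) =
      value_word m e 0 v @ spent (v \<notin> e ` {1..m})"
    and "value_word (Suc m) (e(Suc m := v)) (Suc v) (Suc (Suc m)) =
      value_word m e (Suc v) (Suc m) @ [True]"
proof -
  let ?e = "e(Suc m := v)"
  have I: "{1..Suc m} = insert (Suc m) {1..m}" by auto
  have img: "?e ` {1..Suc m} = insert v (e ` {1..m})" unfolding I by auto
  have us: "usable (Suc m) ?e u = usable m e u" if "u \<noteq> v" for u
    using that unfolding usable_def I by auto
  have usv: "usable (Suc m) ?e v \<longleftrightarrow> v \<notin> e ` {1..m}"
  proof
    assume us': "usable (Suc m) ?e v"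
    show "v \<notin> e ` {1..m}"
    proof
      assume "v \<in> e ` {1..m}"
      then obtain i where "i \<in> {1..m}" "e i = v" by blast
      then have "i \<in> {1..Suc m}" "Suc m \<in> {1..Suc m}" "i < Suc m" "?e i = v" "?e (Suc m) = v"
        by auto
      then show False using us' unfolding usable_def by blast
    qed
  next
    assume new: "v \<notin> e ` {1..m}"
    have "?e i \<noteq> v" if "i \<in> {1..Suc m}" "j \<in> {1..Suc m}" "i < j" for i j
      using that new by auto
    then show "usable (Suc m) ?e v" unfolding usable_def by blast
  qed
  have other: "value_word (Suc m) ?e lo hi = value_word m e lo hi" if "v \<notin> {lo..<hi}" for lo hi
  proof -
    have "filter (usable (Suc m) ?e) [lo..<hi] = filter (usable m e) [lo..<hi]"
      using that us by (intro filter_cong) auto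
    then show ?thesis using that unfolding value_word_def img by auto
  qed
  have "value_word (Suc m) ?e 0 (Suc v) = value_word (Suc m) ?e 0 v @ value_word (Suc m) ?e v (Suc v)"
    by (simp add: value_word_append)
  then show "value_word (Suc m) ?e 0 (Suc v) = value_word m e 0 v @ spent (v \<notin> e ` {1..m})"
    using usv by (simp add: other) (simp add: value_word_def img spent_def)
  have "e i < i" if "i \<in> {1..m}" for i
    using e that by (simp add: inv_seqs_000_def inv_seqs_def PiE_iff)
  then have lt: "e i < Suc m" if "i \<in> {1..m}" for i
    using that by (meson atLeastAtMost_iff le_less_trans less_Suc_eq_le less_imp_le)
  have "value_word m e (Suc m) (Suc (Suc m)) = [True]"
  proof -
    have "Suc m \<notin> e ` {1..m}" using lt by (metis imageE less_irrefl)
    moreover from this have "usable m e (Suc m)" unfolding usable_def by (metis imageI)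
    ultimately show ?thesis by (simp add: value_word_def)
  qed
  then show "value_word (Suc m) ?e (Suc v) (Suc (Suc m)) = value_word m e (Suc v) (Suc m) @ [True]"
    using v(1) value_word_append[of "Suc v" "Suc m" "Suc (Suc m)" m e] by (simp add: other)
qed

lemma seq_asc_extend:
  assumes "m \<ge> 1"
  shows "seq_asc (Suc m) (e(Suc m := v)) = seq_asc m e + (if e m < v then 1 else 0)"
proof -
  have "{i \<in> {1..Suc m - 1}. (e(Suc m := v)) i < (e(Suc m := v)) (i + 1)} =
      {i \<in> {1..m - 1}. e i < e (i + 1)} \<union> (if e m < v then {m} else {})"
    using assms by (auto simp: le_Suc_eq split: if_splits)
  moreover have "m \<notin> {i \<in> {1..m - 1}. e i < e (i + 1)}"
    using assms by auto
  ultimately show ?thesis by (simp add: seq_asc_def)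
qed

lemma seq_dist_extend:
  assumes "m \<ge> 1" "e 1 = 0"
  shows "seq_dist (Suc m) (e(Suc m := v)) = seq_dist m e + (if v \<notin> e ` {1..m} then 1 else 0)"
proof -
  have I: "{1..Suc m} = insert (Suc m) {1..m}" by auto
  have img: "(e(Suc m := v)) ` {1..Suc m} = insert v (e ` {1..m})" unfolding I by auto
  \<comment> \<open>The value 0 is taken by the first entry, so a value that is new is positive and
    counts.\<close>
  have "0 \<in> e ` {1..m}" using assms by force
  then have "{u \<in> insert v (e ` {1..m}). u > 0} =
     {u \<in> e ` {1..m}. u > 0} \<union> (if v \<notin> e ` {1..m} then {v} else {})"
    by (auto intro: gr0I)
  then show ?thesis unfolding seq_dist_def img by auto
qed

text \<open>Each sequence of length \<open>m\<close> collects the weight of all its continuations.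
  The induction splits off the first appended entry, so \<open>m\<close> has to vary.\<close>

lemma inv_seqs_000_sum_growth:
  fixes s t :: "'a::comm_semiring_1"
  assumes "m \<ge> 1"
  shows "(\<Sum>e\<in>inv_seqs_000 (m + k). s ^ seq_asc (m + k) e * t ^ seq_dist (m + k) e) =
    (\<Sum>e\<in>inv_seqs_000 m. s ^ seq_asc m e * t ^ seq_dist m e *
      growth s t k (value_word m e 0 (Suc (e m))) (value_word m e (Suc (e m)) (Suc m)))"
  using assms
proof (induction k arbitrary: m)
  case (Suc k)
  let ?wt = "\<lambda>m e. s ^ seq_asc m e * t ^ seq_dist m e"
  let ?G = "\<lambda>k m e. growth s t k (value_word m e 0 (Suc (e m))) (value_word m e (Suc (e m)) (Suc m))"
  let ?V = "\<lambda>e. {v\<in>{0..<Suc m}. usable m e v}"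
  have step: "(\<Sum>v\<in>?V e. ?wt (Suc m) (e(Suc m := v)) * ?G k (Suc m) (e(Suc m := v))) =
      ?wt m e * ?G (Suc k) m e" if e: "e \<in> inv_seqs_000 m" for e
  proof -
    have em: "e m < m" and e1: "e 1 = 0"
      using e Suc.prems by (auto simp: inv_seqs_000_def inv_seqs_def PiE_iff)
    \<comment> \<open>The mark is at \<open>e m\<close>: values up to it create no ascent, values
      above it create one and contribute the factor \<open>s\<close>.\<close>
    have split: "?V e = {v\<in>{0..<Suc (e m)}. usable m e v} \<union> {v\<in>{Suc (e m)..<Suc m}. usable m e v}"
      using em by auto
    define h where "h v = pick_weight t (v \<notin> e ` {1..m}) *
      growth s t k (value_word m e 0 v @ spent (v \<notin> e ` {1..m}))
        (value_word m e (Suc v) (Suc m) @ [True])" for v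
    have "?wt (Suc m) (e(Suc m := v)) * ?G k (Suc m) (e(Suc m := v)) =
        ?wt m e * ((if e m < v then s else 1) * h v)" if "v \<in> ?V e" for v
      using that value_word_extend[OF e, of v] Suc.prems e1
      by (auto simp: seq_asc_extend seq_dist_extend h_def pick_weight_def algebra_simps)
    then have "(\<Sum>v\<in>?V e. ?wt (Suc m) (e(Suc m := v)) * ?G k (Suc m) (e(Suc m := v))) =
        ?wt m e * (\<Sum>v\<in>?V e. (if e m < v then s else 1) * h v)"
      by (simp add: sum_distrib_left)
    also have "(\<Sum>v\<in>?V e. (if e m < v then s else 1) * h v) =
       (\<Sum>v\<in>{v\<in>{0..<Suc (e m)}. usable m e v}. (if e m < v then s else 1) * h v) +
       (\<Sum>v\<in>{v\<in>{Suc (e m)..<Suc m}. usable m e v}. (if e m < v then s else 1) * h v)"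
      unfolding split by (rule sum.union_disjoint) auto
    also have "(\<Sum>v\<in>{v\<in>{0..<Suc (e m)}. usable m e v}. (if e m < v then s else 1) * h v) =
       (\<Sum>v\<in>{v\<in>{0..<Suc (e m)}. usable m e v}. h v)"
      by (rule sum.cong) auto
    also have "(\<Sum>v\<in>{v\<in>{Suc (e m)..<Suc m}. usable m e v}. (if e m < v then s else 1) * h v) =
       s * (\<Sum>v\<in>{v\<in>{Suc (e m)..<Suc m}. usable m e v}. h v)"
      unfolding sum_distrib_left by (rule sum.cong) auto
    also have "(\<Sum>v\<in>{v\<in>{0..<Suc (e m)}. usable m e v}. h v) +
        s * (\<Sum>v\<in>{v\<in>{Suc (e m)..<Suc m}. usable m e v}. h v) = ?G (Suc k) m e"
    proof -
      \<comment> \<open>These two equations glue the words on the two sides of the mark, so that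
        both \<open>picks\<close> sums of \<open>growth\<close> have summand
        \<open>h v\<close>.\<close>
      have 1: "value_word m e (Suc v) (Suc (e m)) @ value_word m e (Suc (e m)) (Suc m) @ [True] =
          value_word m e (Suc v) (Suc m) @ [True]" if "v < Suc (e m)" for v
        using that em value_word_append[of "Suc v" "Suc (e m)" "Suc m"]
        by (metis append_assoc less_eq_Suc_le nat_less_le Suc_le_mono)
      have 2: "value_word m e 0 (Suc (e m)) @ value_word m e (Suc (e m)) v @ w =
          value_word m e 0 v @ w" if "Suc (e m) \<le> v" for v w
        using that value_word_append[of 0 "Suc (e m)" v] by (metis append_assoc le0)
      show ?thesis
        using em by (simp add: picks_value_word h_def 1 2)
    qed
    finally show ?thesis .
  qed
  have "(\<Sum>e\<in>inv_seqs_000 (m + Suc k). ?wt (m + Suc k) e) =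
      (\<Sum>e\<in>inv_seqs_000 (Suc m). ?wt (Suc m) e * ?G k (Suc m) e)"
    using Suc.IH[of "Suc m"] by simp
  also have "\<dots> = (\<Sum>(e, v)\<in>(SIGMA e:inv_seqs_000 m. ?V e).
      ?wt (Suc m) (e(Suc m := v)) * ?G k (Suc m) (e(Suc m := v)))"
    unfolding sum.reindex_bij_betw[OF inv_seqs_000_Suc, symmetric]
    by (rule sum.cong) auto
  also have "\<dots> = (\<Sum>e\<in>inv_seqs_000 m. \<Sum>v\<in>?V e.
      ?wt (Suc m) (e(Suc m := v)) * ?G k (Suc m) (e(Suc m := v)))"
    by (rule sum.Sigma[symmetric]) (auto simp: finite_inv_seqs_000)
  also have "\<dots> = (\<Sum>e\<in>inv_seqs_000 m. ?wt m e * ?G (Suc k) m e)"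
    by (rule sum.cong[OF refl step])
  finally show ?case .
qed simp

section \<open>Simsun permutations\<close>

fun starts_descent :: "nat list \<Rightarrow> bool" where
  "starts_descent (x # y # v) \<longleftrightarrow> x > y"
| "starts_descent _ \<longleftrightarrow> False"

lemma no_double_descent_Nil [simp]: "no_double_descent []"
  by (simp add: no_double_descent_def)

lemma no_double_descent_Cons:
  "no_double_descent (x # v) \<longleftrightarrow>
     no_double_descent v \<and> \<not> (starts_descent (x # v) \<and> starts_descent v)"
proof -
  have *: "(\<exists>i. Q i) \<longleftrightarrow> Q 0 \<or> (\<exists>i. Q (Suc i))" for Q :: "nat \<Rightarrow> bool"
    by (metis not0_implies_Suc)
  have "starts_descent (x # v) \<and> starts_descent v \<longleftrightarrow>
      2 < length (x # v) \<and> (x # v) ! 0 > (x # v) ! 1 \<and> (x # v) ! 1 > (x # v) ! 2"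
    by (cases v rule: starts_descent.cases) auto
  then show ?thesis
    unfolding no_double_descent_def
    by (subst *) (auto simp: numeral_2_eq_2)
qed

lemma no_double_descent_append2: "no_double_descent (u @ v) \<Longrightarrow> no_double_descent v"
  by (induction u) (auto simp: no_double_descent_Cons)

text \<open>The letter before \<open>N\<close> ascends to it, so a new double descent can only begin
  at \<open>N\<close> itself.\<close>

lemma no_double_descent_insert:
  assumes "no_double_descent (u @ v)" "\<And>x. x \<in> set (u @ v) \<Longrightarrow> x < N"
  shows "no_double_descent (u @ N # v) \<longleftrightarrow> \<not> starts_descent v"
  using assms
proof (induction u)
  case Nil
  then show ?case
    by (cases v rule: starts_descent.cases) (auto simp: no_double_descent_Cons)
next
  case (Cons x u)
  have "\<not> (starts_descent (x # u @ N # v) \<and> starts_descent (u @ N # v))"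
    using Cons.prems
    by (cases u rule: starts_descent.cases) (auto simp: no_double_descent_Cons less_not_sym)
  then show ?case
    using Cons by (auto simp: no_double_descent_Cons)
qed

text \<open>The gaps before the letters of the second argument, which is preceded by \<open>p\<close> (0 at the start of
  a word) and followed by \<open>b\<close>; a maximum cannot be inserted directly before a descent.\<close>

primrec gap_word :: "nat \<Rightarrow> nat list \<Rightarrow> nat list \<Rightarrow> bool list" where
  "gap_word p [] b = []"
| "gap_word p (x # v) b =
     (if starts_descent (x # v @ b) then [] else [p > x]) @ gap_word x v b"

lemma gap_word_append:
  "gap_word p (u @ v) b = gap_word p u (v @ b) @ gap_word (last (p # u)) v b"
  by (induction u arbitrary: p) auto

text \<open>Deciding whether a gap before a letter of \<open>u\<close> is open looks at most one
  letter beyond \<open>u\<close>.\<close>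

lemma gap_word_context: "gap_word p u (y # b) = gap_word p u (y # b')"
proof (induction u arbitrary: p)
  case (Cons x u)
  then show ?case by (cases u) auto
qed simp

text \<open>A maximum placed at the end adds an ascent, hence \<open>True\<close> for empty
  \<open>v\<close>. The default 0 makes the gap before the first letter of a nonempty word
  \<open>False\<close>.\<close>

definition gap_type :: "nat list \<Rightarrow> nat list \<Rightarrow> bool" where
  "gap_type u v \<longleftrightarrow> v = [] \<or> last (0 # u) > hd v"

text \<open>The gap directly before \<open>v\<close> is the one being filled, so the count starts
  behind the first letter of \<open>v\<close>. The final \<open>True\<close> is the end of the word;
  for empty \<open>v\<close> that gap is itself the filled one.\<close>

definition gaps_after :: "nat list \<Rightarrow> bool list" where
  "gaps_after v = (case v of [] \<Rightarrow> [] | x # v \<Rightarrow> gap_word x v [] @ [True])"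

text \<open>The growth rule for permutations. Inside the word, a filled \<open>True\<close> gap lies
  in a descent; \<open>N\<close> breaks this descent and so opens the gap before its first letter,
  as a \<open>False\<close> one. At the end of the word the new \<open>False\<close> is the gap
  before \<open>N\<close>.\<close>

lemma gap_word_insert:
  assumes "no_double_descent (u @ v)" "\<not> starts_descent v" "\<And>x. x \<in> set (u @ v) \<Longrightarrow> x < N" "N > 0"
  shows "gap_word 0 (u @ [N]) v = gap_word 0 u v @ spent (gap_type u v)"
    and "gap_word N v [] @ [True] = True # gaps_after v"
proof -
  show "gap_word N v [] @ [True] = True # gaps_after v"
    using assms by (cases v) (auto simp: gaps_after_def)
  show "gap_word 0 (u @ [N]) v = gap_word 0 u v @ spent (gap_type u v)"
  proof (cases u rule: rev_cases)
    case Nil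
    then show ?thesis
      using assms by (cases v) (auto simp: gap_type_def spent_def)
  next
    case (snoc u0 y)
    have yN: "y < N" using assms(3) snoc by auto
    have ctx: "gap_word 0 u0 (y # N # v) = gap_word 0 u0 (y # v)"
      by (rule gap_word_context)
    show ?thesis
    proof (cases v)
      case Nil
      with yN show ?thesis unfolding snoc
        by (auto simp: gap_word_append ctx gap_type_def spent_def gap_word_context[of _ _ y "[N]" "[]"])
    next
      case (Cons z v')
      \<comment> \<open>Absence of double descents makes the reopened gap before \<open>y\<close> a
        \<open>False\<close> one.\<close>
      have "\<not> y < last (0 # u0)" if "z < y"
      proof (cases u0 rule: rev_cases)
        case (snoc u1 q)
        have "no_double_descent (q # y # z # v')"
          using assms(1) no_double_descent_append2[of u1 "q # y # z # v'"] \<open>u = u0 @ [y]\<close> snoc Cons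
          by simp
        then show ?thesis using that snoc by (auto simp: no_double_descent_Cons)
      qed simp
      moreover have "z < N" using assms(3) Cons by auto
      ultimately show ?thesis
        using yN Cons gap_word_context[of 0 u0 y "N # v" v] unfolding snoc
        by (auto simp: gap_word_append gap_type_def spent_def)
    qed
  qed
qed

text \<open>Closed gaps contribute 0, so the sum can run over all positions.\<close>

lemma picks_gap_word:
  "picks f c (gap_word p w b) = (\<Sum>i<length w. if starts_descent (drop i w @ b) then 0 else
     f (c @ gap_word p (take i w) (drop i w @ b)) (last (p # take i w) > hd (drop i w))
       (gap_word (hd (drop i w)) (tl (drop i w)) b))"
proof (induction w arbitrary: c p)
  case (Cons x w)
  have "picks f c' (gap_word x w b) = (\<Sum>i<length w. if starts_descent (drop i w @ b) then 0 else
     f (c' @ gap_word x (take i w) (drop i w @ b)) (last (x # take i w) > hd (drop i w))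
       (gap_word (hd (drop i w)) (tl (drop i w)) b))" for c'
    by (rule Cons.IH)
  moreover have split: "take i w @ drop i w @ b = w @ b" for i
    by (metis append_assoc append_take_drop_id)
  ultimately show ?case
    by (auto simp: split sum.lessThan_Suc_shift picks_append simp del: sum.lessThan_Suc
        intro!: arg_cong2[where f = "(+)"] sum.cong)
qed simp

text \<open>Here \<open>u\<close> is the part of the word up to the mark. The term \<open>h\<close>
  has the new \<open>True\<close> directly after the mark, as insertion produces it, whereas
  \<open>growth\<close> puts it at the far right.\<close>

lemma growth_gap_word:
  fixes s t :: "'a::comm_semiring_1"
  defines "h \<equiv> \<lambda>k a b. if starts_descent b then 0 else
    pick_weight t (gap_type a b) * growth s t k (gap_word 0 a b @ spent (gap_type a b)) (True # gaps_after b)"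
  shows "growth s t (Suc k) (gap_word 0 u v) (gap_word (last (0 # u)) v [] @ [True]) =
    (\<Sum>i\<le>length (u @ v). (if i < length u then 1 else s) * h k (take i (u @ v)) (drop i (u @ v)))"
proof -
  have rot: "growth s t k L (b @ [True]) = growth s t k L (True # b)" for L b
    using growth_rotate[of s t k L "[]" True b] by simp
  let ?w = "u @ v"
  have left: "picks (\<lambda>a x b. pick_weight t x *
      growth s t k (a @ spent x) (b @ (gap_word (last (0 # u)) v [] @ [True]) @ [True])) [] (gap_word 0 u v) =
    (\<Sum>i<length u. h k (take i ?w) (drop i ?w))"
    unfolding picks_gap_word
  proof (intro sum.cong refl)
    fix i assume "i \<in> {..<length u}"
    then obtain x u' where u': "drop i u = x # u'"
      by (metis Cons_nth_drop_Suc lessThan_iff)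
    have "last (0 # u) = last (x # u')"
      using u' by (metis append_take_drop_id last.simps last_append list.distinct(1) append_is_Nil_conv)
    then have "gap_word x u' v @ gap_word (last (0 # u)) v [] = gap_word x (u' @ v) []"
      by (simp add: gap_word_append)
    then have "growth s t k L (gap_word x u' v @ gap_word (last (0 # u)) v [] @ [True, True]) =
        growth s t k L (True # gap_word x (u' @ v) [] @ [True])" for L
      using rot[of L "gap_word x (u' @ v) [] @ [True]"] by (metis append_assoc append_Cons append_Nil)
    then show "(if starts_descent (drop i u @ v) then 0 else pick_weight t (hd (drop i u) < last (0 # take i u)) *
        growth s t k (([] @ gap_word 0 (take i u) (drop i u @ v)) @ spent (hd (drop i u) < last (0 # take i u)))
         (gap_word (hd (drop i u)) (tl (drop i u)) v @ (gap_word (last (0 # u)) v [] @ [True]) @ [True]))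
       = h k (take i ?w) (drop i ?w)"
      using u' \<open>i \<in> _\<close>
      by (auto simp: h_def gap_type_def gaps_after_def simp del: last.simps)
  qed
  have right: "picks (\<lambda>a x b. pick_weight t x * growth s t k (a @ spent x) (b @ [True]))
      (gap_word 0 u v) (gap_word (last (0 # u)) v [] @ [True]) =
    (\<Sum>i\<le>length v. h k (take (length u + i) ?w) (drop (length u + i) ?w))"
    unfolding picks_append lessThan_Suc_atMost[symmetric] sum.lessThan_Suc picks_gap_word
  proof (intro arg_cong2[where f = "(+)"] sum.cong refl)
    fix i assume "i \<in> {..<length v}"
    then obtain x v' where v': "drop i v = x # v'"
      by (metis Cons_nth_drop_Suc lessThan_iff)
    have "last (last (0 # u) # take i v) = last (0 # u @ take i v)"
      by auto
    then show "(if starts_descent (drop i v @ []) then 0 else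
        pick_weight t (hd (drop i v) < last (last (0 # u) # take i v)) *
        growth s t k ((gap_word 0 u v @ gap_word (last (0 # u)) (take i v) (drop i v @ [])) @
            spent (hd (drop i v) < last (last (0 # u) # take i v)))
         ((gap_word (hd (drop i v)) (tl (drop i v)) [] @ [True]) @ [True]))
       = h k (take (length u + i) ?w) (drop (length u + i) ?w)"
      using v' append_take_drop_id[of i v] gap_word_append[of 0 u "take i v" "drop i v"] rot[of _ "gap_word x v' [] @ [True]"]
      by (auto simp: h_def gap_type_def gaps_after_def simp del: last.simps)
  next
    \<comment> \<open>The trailing \<open>True\<close> has no letter behind it; it is the gap at the
      end of the word, the position \<open>length v\<close>.\<close>
    show "picks (\<lambda>a x b. pick_weight t x * growth s t k (a @ spent x) (b @ [True]))
     (gap_word 0 u v @ gap_word (last (0 # u)) v []) [True] =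
    h k (take (length u + length v) (u @ v)) (drop (length u + length v) (u @ v))"
      using gap_word_append[of 0 u v "[]"]
      by (simp add: h_def gap_type_def gaps_after_def del: last.simps)
  qed
  have "{..length ?w} = {..<length u} \<union> (\<lambda>i. length u + i) ` {..length v}"
    unfolding atMost_atLeast0 image_add_atLeastAtMost by auto
  then have "(\<Sum>i\<le>length ?w. (if i < length u then 1 else s) * h k (take i ?w) (drop i ?w)) =
    (\<Sum>i<length u. (if i < length u then 1 else s) * h k (take i ?w) (drop i ?w)) +
    (\<Sum>i\<in>(\<lambda>i. length u + i) ` {..length v}. (if i < length u then 1 else s) * h k (take i ?w) (drop i ?w))"
    by (simp only:) (rule sum.union_disjoint, auto)
  also have "\<dots> = (\<Sum>i<length u. h k (take i ?w) (drop i ?w)) +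
     s * (\<Sum>i\<le>length v. h k (take (length u + i) ?w) (drop (length u + i) ?w))"
    by (simp add: sum.reindex sum_distrib_left)
  finally show ?thesis
    using left right by simp
qed

section \<open>Ascents and inverse ascents of words\<close>

fun word_asc :: "nat list \<Rightarrow> nat" where
  "word_asc (x # y # v) = (if x < y then 1 else 0) + word_asc (y # v)"
| "word_asc _ = 0"

lemma word_asc_append: "word_asc (u @ y # v) = word_asc (u @ [y]) + word_asc (y # v)"
  by (induction u rule: word_asc.induct) auto

text \<open>Between two letters, \<open>N\<close> replaces their comparison by an ascent followed by
  a descent, which is a gain exactly if they formed a descent.\<close>

lemma word_asc_insert:
  assumes "u @ v \<noteq> []" "distinct (u @ v)" "\<And>x. x \<in> set (u @ v) \<Longrightarrow> x < N"
  shows "word_asc (u @ N # v) = word_asc (u @ v) + (if gap_type u v then 1 else 0)"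
proof (cases u rule: rev_cases)
  case Nil
  then obtain x v' where v: "v = x # v'"
    using assms(1) by (cases v) auto
  have "x < N" using assms(3) v by simp
  then show ?thesis using Nil v by (simp add: gap_type_def)
next
  case (snoc u0 y)
  have "y < N" using assms(3) snoc by simp
  show ?thesis
  proof (cases v)
    case Nil
    then show ?thesis
      using snoc \<open>y < N\<close> word_asc_append[of u0 y "[N]"] by (simp add: gap_type_def)
  next
    case (Cons z v')
    have "z < N" "y \<noteq> z" using assms(2,3) snoc Cons by auto
    then show ?thesis
      using snoc Cons \<open>y < N\<close> word_asc_append[of u0 y "N # v"] word_asc_append[of u0 y v]
      by (auto simp: gap_type_def)
  qed
qed

text \<open>For the word of a permutation these are the ascents of the inverse: \<open>i\<close>
  counts if it stands to the left of \<open>Suc i\<close>.\<close>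

definition word_iasc :: "nat \<Rightarrow> nat list \<Rightarrow> nat" where
  "word_iasc m w = card {i\<in>{1..<m}. i \<in> set (takeWhile (\<lambda>x. x \<noteq> Suc i) w)}"

text \<open>The old letters keep their relative order, so only the pair \<open>m\<close>,
  \<open>Suc m\<close> is new. This yields the factor \<open>s\<close> for an insertion to the right
  of the mark.\<close>

lemma word_iasc_insert:
  assumes "m \<ge> 1" "Suc m \<notin> set (u @ v)"
  shows "word_iasc (Suc m) (u @ Suc m # v) = word_iasc m (u @ v) + (if m \<in> set u then 1 else 0)"
proof -
  have "i \<in> set (takeWhile (\<lambda>x. x \<noteq> Suc i) (u @ Suc m # v)) \<longleftrightarrow>
      i \<in> set (takeWhile (\<lambda>x. x \<noteq> Suc i) (u @ v))" if "i < m" for i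
    using that by (cases "Suc i \<in> set u") (auto simp: takeWhile_append)
  moreover have "takeWhile (\<lambda>x. x \<noteq> Suc m) (u @ Suc m # v) = u"
    using assms by (auto simp: takeWhile_append)
  ultimately have "{i\<in>{1..<Suc m}. i \<in> set (takeWhile (\<lambda>x. x \<noteq> Suc i) (u @ Suc m # v))} =
     {i\<in>{1..<m}. i \<in> set (takeWhile (\<lambda>x. x \<noteq> Suc i) (u @ v))} \<union> (if m \<in> set u then {m} else {})"
    using assms(1) by (auto simp: less_Suc_eq)
  then show ?thesis by (simp add: word_iasc_def)
qed

section \<open>Simsun words and insertion of the next maximum\<close>

definition simsun_words :: "nat \<Rightarrow> nat list set" where
  "simsun_words m = {w. distinct w \<and> set w = {1..m} \<and>
     (\<forall>k\<in>{1..m}. no_double_descent (filter (\<lambda>v. v \<le> k) w))}"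

lemma finite_simsun_words: "finite (simsun_words m)"
proof (rule finite_subset)
  show "simsun_words m \<subseteq> {w. set w \<subseteq> {1..m} \<and> length w = m}"
    by (auto simp: simsun_words_def dest: distinct_card)
qed (simp add: finite_lists_length_eq)

lemma simsun_wordsD:
  assumes "w \<in> simsun_words m"
  shows "length w = m" "distinct w" "set w = {1..m}" "no_double_descent w"
proof -
  show w: "distinct w" "set w = {1..m}" using assms by (auto simp: simsun_words_def)
  then show "length w = m" using distinct_card[of w] by simp
  show "no_double_descent w"
  proof (cases "m = 0")
    case False
    have "filter (\<lambda>v. v \<le> m) w = w" using w(2) by (simp add: filter_id_conv)
    moreover have "m \<in> {1..m}" using False by simp
    ultimately show ?thesis
      using assms unfolding simsun_words_def by (metis (no_types, lifting) mem_Collect_eq)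
  qed (use w in simp)
qed

text \<open>The restrictions to values at most \<open>k\<close> with \<open>k \<le> m\<close> do not
  see \<open>Suc m\<close>, so only the condition on the whole word is new.\<close>

lemma simsun_words_Suc_iff:
  assumes "Suc m \<notin> set (u @ v)"
  shows "u @ Suc m # v \<in> simsun_words (Suc m) \<longleftrightarrow> u @ v \<in> simsun_words m \<and> \<not> starts_descent v"
proof -
  have set: "set (u @ Suc m # v) = {1..Suc m} \<longleftrightarrow> set (u @ v) = {1..m}"
  proof -
    have "{1..Suc m} = insert (Suc m) {1..m}" by auto
    then show ?thesis using assms insert_ident[of "Suc m" "set (u @ v)" "{1..m}"] by simp
  qed
  show ?thesis
  proof (cases "distinct (u @ v) \<and> set (u @ v) = {1..m}")
    case True
    have below: "x < Suc m" if "x \<in> set (u @ v)" for x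
      using True that by auto
    have "filter (\<lambda>v. v \<le> Suc m) (u @ Suc m # v) = u @ Suc m # v"
      using below by (auto simp: filter_id_conv less_imp_le)
    moreover have "filter (\<lambda>v. v \<le> k) (u @ Suc m # v) = filter (\<lambda>v. v \<le> k) (u @ v)" if "k \<le> m" for k
      using that by simp
    moreover have "{1..Suc m} = insert (Suc m) {1..m}" by auto
    ultimately have "(\<forall>k\<in>{1..Suc m}. no_double_descent (filter (\<lambda>v. v \<le> k) (u @ Suc m # v))) \<longleftrightarrow>
        (\<forall>k\<in>{1..m}. no_double_descent (filter (\<lambda>v. v \<le> k) (u @ v))) \<and>
        no_double_descent (u @ Suc m # v)"
      by auto
    moreover have "distinct (u @ Suc m # v)" using conjunct1[OF True] assms by auto
    ultimately have "u @ Suc m # v \<in> simsun_words (Suc m) \<longleftrightarrow>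
        u @ v \<in> simsun_words m \<and> no_double_descent (u @ Suc m # v)"
      using True set unfolding simsun_words_def by blast
    then show ?thesis
      using no_double_descent_insert[OF _ below] simsun_wordsD(4) by metis
  next
    case False
    then show ?thesis
      using assms set by (auto simp: simsun_words_def)
  qed
qed

lemma filter_neq_id: "x \<notin> set w \<Longrightarrow> filter (\<lambda>v. v \<noteq> x) w = w"
  by (rule filter_True) auto

lemma simsun_words_Suc:
  "bij_betw (\<lambda>(w, i). take i w @ Suc m # drop i w)
     (SIGMA w:simsun_words m. {i\<in>{..m}. \<not> starts_descent (drop i w)}) (simsun_words (Suc m))"
proof (rule bij_betwI[where g = "\<lambda>w. (filter (\<lambda>v. v \<noteq> Suc m) w, length (takeWhile (\<lambda>v. v \<noteq> Suc m) w))"],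
    goal_cases)
  case 1
  show ?case
  proof (intro Pi_I)
    fix p assume "p \<in> (SIGMA w:simsun_words m. {i\<in>{..m}. \<not> starts_descent (drop i w)})"
    then obtain w i where p: "p = (w, i)" "w \<in> simsun_words m" "\<not> starts_descent (drop i w)"
      by auto
    then show "(case p of (w, i) \<Rightarrow> take i w @ Suc m # drop i w) \<in> simsun_words (Suc m)"
      using simsun_words_Suc_iff[of m "take i w" "drop i w"] simsun_wordsD(3)[of w m] by simp
  qed
next
  case 2
  show ?case
  proof (intro Pi_I)
    fix w assume w: "w \<in> simsun_words (Suc m)"
    then obtain u v where uv: "w = u @ Suc m # v"
      using simsun_wordsD(3)[OF w] by (metis atLeastAtMost_iff le_add1 order_refl plus_1_eq_Suc split_list)
    have nin: "Suc m \<notin> set (u @ v)"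
      using simsun_wordsD(2)[OF w] uv by auto
    then have "filter (\<lambda>v. v \<noteq> Suc m) w = u @ v"
      using uv by (auto simp: filter_neq_id)
    moreover have "takeWhile (\<lambda>v. v \<noteq> Suc m) w = u"
      using uv nin by (auto simp: takeWhile_append)
    moreover have "u @ v \<in> simsun_words m" "\<not> starts_descent v"
      using w simsun_words_Suc_iff[OF nin] uv by auto
    ultimately show "(filter (\<lambda>v. v \<noteq> Suc m) w, length (takeWhile (\<lambda>v. v \<noteq> Suc m) w)) \<in>
       (SIGMA w:simsun_words m. {i\<in>{..m}. \<not> starts_descent (drop i w)})"
      using simsun_wordsD(1)[of "u @ v" m] by auto
  qed
next
  case (3 p)
  then obtain w i where p: "p = (w, i)" "w \<in> simsun_words m" "i \<le> m" by auto
  have w: "Suc m \<notin> set w" "length w = m" using simsun_wordsD[OF p(2)] by auto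
  have "Suc m \<notin> set (take i w)" "Suc m \<notin> set (drop i w)"
    using w(1) by (auto dest: in_set_takeD in_set_dropD)
  then have "filter (\<lambda>v. v \<noteq> Suc m) (take i w @ Suc m # drop i w) = take i w @ drop i w"
    "takeWhile (\<lambda>v. v \<noteq> Suc m) (take i w @ Suc m # drop i w) = take i w"
    by (auto simp: filter_neq_id takeWhile_append simp del: append_take_drop_id)
  then show ?case using p w by simp
next
  case (4 w)
  then obtain u v where uv: "w = u @ Suc m # v"
    using simsun_wordsD(3)[OF 4] by (metis atLeastAtMost_iff le_add1 order_refl plus_1_eq_Suc split_list)
  have nin: "Suc m \<notin> set (u @ v)"
    using simsun_wordsD(2)[OF 4] uv by auto
  then have "filter (\<lambda>v. v \<noteq> Suc m) w = u @ v" "takeWhile (\<lambda>v. v \<noteq> Suc m) w = u"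
    using uv by (auto simp: filter_neq_id takeWhile_append)
  then show ?case using uv by simp
qed

text \<open>The mark stands just behind the letter \<open>m\<close>, hence the \<open>Suc\<close>;
  the appended \<open>True\<close> is the gap at the end of the word.\<close>

definition marked_growth :: "'a::comm_semiring_1 \<Rightarrow> 'a \<Rightarrow> nat \<Rightarrow> nat \<Rightarrow> nat list \<Rightarrow> 'a" where
  "marked_growth s t k m w = (let j = Suc (length (takeWhile (\<lambda>x. x \<noteq> m) w)) in
     growth s t k (gap_word 0 (take j w) (drop j w)) (gap_word m (drop j w) [] @ [True]))"

lemma marked_growth_append:
  "m \<notin> set u \<Longrightarrow> marked_growth s t k m (u @ m # v) =
     growth s t k (gap_word 0 (u @ [m]) v) (gap_word m v [] @ [True])"
  by (simp add: marked_growth_def takeWhile_append)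

text \<open>The counterpart of \<open>inv_seqs_000_sum_growth\<close>, with the gaps in place of the
  values.\<close>

lemma simsun_words_sum_growth:
  fixes s t :: "'a::comm_semiring_1"
  assumes "m \<ge> 1"
  shows "(\<Sum>w\<in>simsun_words (m + k). s ^ word_iasc (m + k) w * t ^ word_asc w) =
    (\<Sum>w\<in>simsun_words m. s ^ word_iasc m w * t ^ word_asc w * marked_growth s t k m w)"
  using assms
proof (induction k arbitrary: m)
  case 0
  then show ?case by (simp add: marked_growth_def Let_def)
next
  case (Suc k)
  let ?wt = "\<lambda>m w. s ^ word_iasc m w * t ^ word_asc w"
  let ?I = "\<lambda>w. {i\<in>{..m}. \<not> starts_descent (drop i w)}"
  let ?ins = "\<lambda>w i. take i w @ Suc m # drop i w"
  have step: "(\<Sum>i\<in>?I w. ?wt (Suc m) (?ins w i) * marked_growth s t k (Suc m) (?ins w i)) =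
      ?wt m w * marked_growth s t (Suc k) m w" if w: "w \<in> simsun_words m" for w
  proof -
    note w' = simsun_wordsD[OF w]
    obtain a b where ab: "w = a @ m # b"
      using w'(3) Suc.prems by (metis atLeastAtMost_iff order_refl split_list)
    have ma: "m \<notin> set a" and "w \<noteq> []" using w'(2) ab by auto
    define h where "h k a b = (if starts_descent b then 0 else
      pick_weight t (gap_type a b) *
      growth s t k (gap_word 0 a b @ spent (gap_type a b)) (True # gaps_after b))" for k a b
    have "?wt (Suc m) (?ins w i) * marked_growth s t k (Suc m) (?ins w i) =
       ?wt m w * ((if i < length (a @ [m]) then 1 else s) * h k (take i w) (drop i w))"
      if "i \<in> ?I w" for i
    proof -
      have i: "i \<le> m" "\<not> starts_descent (drop i w)" using that by auto
      have below: "x < Suc m" if "x \<in> set (take i w @ drop i w)" for x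
        using that w'(3) by simp
      have nin: "Suc m \<notin> set (take i w @ drop i w)" using below by blast
      have "m \<in> set (take i w) \<longleftrightarrow> \<not> i < length (a @ [m])"
        using ma ab by (auto simp: take_Cons' dest: in_set_takeD)
      then have iasc: "word_iasc (Suc m) (?ins w i) = word_iasc m w + (if i < length (a @ [m]) then 0 else 1)"
        using word_iasc_insert[OF Suc.prems nin] by simp
      have asc: "word_asc (?ins w i) = word_asc w + (if gap_type (take i w) (drop i w) then 1 else 0)"
        using word_asc_insert[of "take i w" "drop i w", OF _ _ below] w'(2) \<open>w \<noteq> []\<close> by simp
      have "marked_growth s t k (Suc m) (?ins w i) =
        growth s t k (gap_word 0 (take i w @ [Suc m]) (drop i w)) (gap_word (Suc m) (drop i w) [] @ [True])"
        using nin by (intro marked_growth_append) (simp del: append_take_drop_id)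
      also have "\<dots> = growth s t k
          (gap_word 0 (take i w) (drop i w) @ spent (gap_type (take i w) (drop i w)))
          (True # gaps_after (drop i w))"
        using gap_word_insert[of "take i w" "drop i w" "Suc m", OF _ i(2) below] w'(4) by simp
      finally show ?thesis
        using i(2) by (simp add: iasc asc h_def pick_weight_def algebra_simps)
    qed
    then have "(\<Sum>i\<in>?I w. ?wt (Suc m) (?ins w i) * marked_growth s t k (Suc m) (?ins w i)) =
        ?wt m w * (\<Sum>i\<in>?I w. (if i < length (a @ [m]) then 1 else s) * h k (take i w) (drop i w))"
      by (simp add: sum_distrib_left)
    also have "(\<Sum>i\<in>?I w. (if i < length (a @ [m]) then 1 else s) * h k (take i w) (drop i w)) =
        (\<Sum>i\<le>m. (if i < length (a @ [m]) then 1 else s) * h k (take i w) (drop i w))"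
      by (rule sum.mono_neutral_left) (auto simp: h_def)
    \<comment> \<open>At the closed positions \<open>h\<close> vanishes, so they may be added to the
      sum.\<close>
    also have "\<dots> = marked_growth s t (Suc k) m w"
    proof -
      have "(a @ [m]) @ b = w" "last (0 # a @ [m]) = m" using ab by simp_all
      then show ?thesis
        using growth_gap_word[of s t k "a @ [m]" b] marked_growth_append[OF ma, of s t "Suc k" b]
        by (simp only: h_def w'(1) ab[symmetric])
    qed
    finally show ?thesis .
  qed
  have "(\<Sum>w\<in>simsun_words (m + Suc k). ?wt (m + Suc k) w) =
      (\<Sum>w\<in>simsun_words (Suc m). ?wt (Suc m) w * marked_growth s t k (Suc m) w)"
    using Suc.IH[of "Suc m"] by simp
  also have "\<dots> = (\<Sum>(w, i)\<in>(SIGMA w:simsun_words m. ?I w).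
      ?wt (Suc m) (?ins w i) * marked_growth s t k (Suc m) (?ins w i))"
    unfolding sum.reindex_bij_betw[OF simsun_words_Suc, symmetric]
    by (rule sum.cong) auto
  also have "\<dots> = (\<Sum>w\<in>simsun_words m. \<Sum>i\<in>?I w.
      ?wt (Suc m) (?ins w i) * marked_growth s t k (Suc m) (?ins w i))"
    by (rule sum.Sigma[symmetric]) (auto simp: finite_simsun_words)
  also have "\<dots> = (\<Sum>w\<in>simsun_words m. ?wt m w * marked_growth s t (Suc k) m w)"
    by (rule sum.cong[OF refl step])
  finally show ?case .
qed

section \<open>Passage from permutations to words\<close>

lemma set_perm_word: "\<pi> permutes {1..n} \<Longrightarrow> set (perm_word n \<pi>) = {1..n}"
  unfolding perm_word_def by (metis atLeastLessThanSuc_atLeastAtMost atLeastLessThan_upt image_set permutes_image)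

lemma perm_word_bij: "bij_betw (perm_word n) (RS n) (simsun_words n)"
proof -
  let ?P = "{\<pi>. \<pi> permutes {1..n}}" and ?W = "{w. set w = {1..n} \<and> distinct w}"
  have inj: "inj_on (perm_word n) ?P"
  proof (rule inj_onI, rule ext)
    fix \<pi> \<sigma> i assume *: "\<pi> \<in> ?P" "\<sigma> \<in> ?P" "perm_word n \<pi> = perm_word n \<sigma>"
    show "\<pi> i = \<sigma> i"
    proof (cases "i \<in> {1..n}")
      case True
      then have "i \<in> set [1..<Suc n]" by (simp del: upt_Suc)
      then show ?thesis using *(3) unfolding perm_word_def map_eq_conv by blast
    qed (use * in \<open>auto simp: permutes_not_in\<close>)
  qed
  have sub: "perm_word n ` ?P \<subseteq> ?W"
  proof (intro image_subsetI CollectI conjI)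
    fix \<pi> assume "\<pi> \<in> ?P"
    then show "set (perm_word n \<pi>) = {1..n}" "distinct (perm_word n \<pi>)"
      by (simp_all add: set_perm_word)
        (simp add: perm_word_def distinct_map permutes_inj_on del: upt_Suc)
  qed
  have "?W \<subseteq> perm_word n ` ?P"
  proof
    fix w assume w: "w \<in> ?W"
    then have len: "length w = n" using distinct_card[of w] by simp
    \<comment> \<open>List positions start at 0, hence the shift; \<open>permutes\<close> demands
      the identity outside \<open>{1..n}\<close>.\<close>
    define \<pi> where "\<pi> i = (if i \<in> {1..n} then w ! (i - 1) else i)" for i
    have word: "perm_word n \<pi> = w"
      using len by (intro nth_equalityI) (auto simp: perm_word_def \<pi>_def simp del: upt_Suc)
    have "inj_on \<pi> {1..n}"
      using w word unfolding perm_word_def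
      by (metis (mono_tags, lifting) atLeastLessThanSuc_atLeastAtMost atLeastLessThan_upt distinct_map mem_Collect_eq)
    moreover have "\<pi> ` {1..n} = {1..n}"
      using w word unfolding perm_word_def
      by (metis (mono_tags, lifting) atLeastLessThanSuc_atLeastAtMost atLeastLessThan_upt image_set mem_Collect_eq)
    ultimately have "\<pi> permutes {1..n}"
      by (intro bij_imp_permutes) (auto simp: bij_betw_def \<pi>_def)
    then show "w \<in> perm_word n ` ?P" using word by auto
  qed
  with inj sub have bij: "bij_betw (perm_word n) ?P ?W"
    by (auto simp: bij_betw_def)
  have "filter (\<lambda>v. v \<notin> {k+1..n}) (perm_word n \<pi>) = filter (\<lambda>v. v \<le> k) (perm_word n \<pi>)"
    if "\<pi> permutes {1..n}" for \<pi> k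
    using set_perm_word[OF that] by (intro filter_cong) auto
  then have RS: "RS n = {\<pi> \<in> ?P. perm_word n \<pi> \<in> simsun_words n}"
    using sub unfolding RS_def simsun_words_def by auto
  have "perm_word n ` RS n = simsun_words n"
  proof (intro equalityI subsetI)
    fix w assume w: "w \<in> simsun_words n"
    then have "w \<in> perm_word n ` ?P"
      using simsun_wordsD(2,3)[OF w] bij_betw_imp_surj_on[OF bij] by simp
    then show "w \<in> perm_word n ` RS n" using w by (auto simp: RS)
  qed (auto simp: RS)
  moreover have "inj_on (perm_word n) (RS n)"
    by (rule inj_on_subset[OF inj]) (auto simp: RS_def)
  ultimately show ?thesis by (simp add: bij_betw_def)
qed

text \<open>By injectivity each of the \<open>n - 1\<close> positions is either an ascent or a
  descent.\<close>

lemma perm_asc_eq_card: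
  assumes "inj_on \<pi> {1..n}"
  shows "perm_asc n \<pi> = card {i\<in>{1..n-1}. \<pi> i < \<pi> (i + 1)}"
proof -
  have "{1..n-1} = {i\<in>{1..n-1}. \<pi> i < \<pi> (i + 1)} \<union> {i\<in>{1..n-1}. \<pi> i > \<pi> (i + 1)}"
  proof -
    have "\<pi> i \<noteq> \<pi> (i + 1)" if "i \<in> {1..n-1}" for i
    proof -
      have "i \<in> {1..n}" "i + 1 \<in> {1..n}" using that by auto
      then show ?thesis using inj_onD[OF assms, of i "i + 1"] by auto
    qed
    then have "\<pi> i < \<pi> (i + 1) \<or> \<pi> i > \<pi> (i + 1)" if "i \<in> {1..n-1}" for i
      using that by (metis neq_iff)
    then show ?thesis by blast
  qed
  then have "card ({i\<in>{1..n-1}. \<pi> i < \<pi> (i + 1)} \<union> {i\<in>{1..n-1}. \<pi> i > \<pi> (i + 1)}) = n - 1"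
    by (metis card_atLeastAtMost diff_Suc_1 Suc_eq_plus1)
  moreover have "card ({i\<in>{1..n-1}. \<pi> i < \<pi> (i + 1)} \<union> {i\<in>{1..n-1}. \<pi> i > \<pi> (i + 1)}) =
      card {i\<in>{1..n-1}. \<pi> i < \<pi> (i + 1)} + card {i\<in>{1..n-1}. \<pi> i > \<pi> (i + 1)}"
    by (rule card_Un_disjoint) auto
  ultimately show ?thesis
    unfolding perm_asc_def perm_des_def by linarith
qed

lemma word_asc_perm_word: "word_asc (perm_word n f) = card {i\<in>{1..n-1}. f i < f (i + 1)}"
proof (induction n)
  case (Suc n)
  show ?case
  proof (cases n)
    case (Suc j)
    have "perm_word (Suc n) f = perm_word j f @ f (Suc j) # [f (Suc (Suc j))]"
      "perm_word n f = perm_word j f @ [f (Suc j)]"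
      by (simp_all add: perm_word_def Suc)
    then have "word_asc (perm_word (Suc n) f) = word_asc (perm_word n f) + (if f n < f (Suc n) then 1 else 0)"
      using word_asc_append[of "perm_word j f" "f (Suc j)" "[f (Suc (Suc j))]"] Suc by simp
    moreover have "{i\<in>{1..Suc n - 1}. f i < f (i + 1)} =
        {i\<in>{1..n-1}. f i < f (i + 1)} \<union> (if f n < f (Suc n) then {n} else {})"
      using Suc by (auto simp: le_Suc_eq)
    moreover have "n \<ge> 1" using Suc by simp
    ultimately show ?thesis using Suc.IH by (simp add: card_insert_if)
  qed (simp add: perm_word_def)
qed (simp add: perm_word_def)

lemma word_iasc_perm_word:
  assumes "\<pi> permutes {1..n}"
  shows "word_iasc n (perm_word n \<pi>) = card {i\<in>{1..n-1}. inv \<pi> i < inv \<pi> (i + 1)}"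
proof -
  have "i \<in> set (takeWhile (\<lambda>x. x \<noteq> Suc i) (perm_word n \<pi>)) \<longleftrightarrow> inv \<pi> i < inv \<pi> (i + 1)"
    if i: "i \<in> {1..<n}" for i
  proof -
    \<comment> \<open>The position of the letter \<open>Suc i\<close>; the \<open>takeWhile\<close>
      returns the letters at positions before \<open>j\<close>.\<close>
    define j where "j = inv \<pi> (Suc i)"
    have j: "j \<in> {1..n}" "\<pi> j = Suc i"
      using permutes_in_image[OF permutes_inv[OF assms], of "Suc i"] i
      by (simp_all add: j_def permutes_inverses[OF assms])
    have "[1..<Suc n] = [1..<j] @ j # [Suc j..<Suc n]"
      using j(1) upt_add_eq_append[of 1 j "Suc n - j"] upt_conv_Cons[of j "Suc n"]
      by (simp del: upt_Suc)
    moreover have "\<pi> x \<noteq> Suc i" if "x < j" for x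
      using that j(2) permutes_inj[OF assms] by (metis injD less_irrefl)
    ultimately have "takeWhile (\<lambda>x. x \<noteq> Suc i) (perm_word n \<pi>) = map \<pi> [1..<j]"
      using j(2) by (simp add: perm_word_def takeWhile_append)
    moreover have "inv \<pi> i \<ge> 1"
      using permutes_in_image[OF permutes_inv[OF assms], of i] i by auto
    moreover have "i \<in> \<pi> ` {1..<j} \<longleftrightarrow> inv \<pi> i < j"
    proof
      assume "inv \<pi> i < j"
      then have "inv \<pi> i \<in> {1..<j}" using \<open>inv \<pi> i \<ge> 1\<close> by simp
      then show "i \<in> \<pi> ` {1..<j}" using permutes_inverses(1)[OF assms] by (metis imageI)
    qed (use permutes_inverses(2)[OF assms] in auto)
    ultimately show ?thesis
      by (simp add: j_def)
  qed
  moreover have "{1..<n} = {1..n-1}" by auto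
  ultimately show ?thesis unfolding word_iasc_def by (metis (mono_tags, lifting) Collect_cong)
qed

theorem theorem5p2:
  fixes n :: nat and s t :: "'a::comm_semiring_1"
  assumes "n \<ge> 1"
  shows "(\<Sum>\<pi>\<in>RS n. s ^ perm_iasc n \<pi> * t ^ perm_asc n \<pi>) =
         (\<Sum>e\<in>inv_seqs_000 n. s ^ seq_asc n e * t ^ seq_dist n e)"
proof -
  obtain k where n: "n = 1 + k" using assms le_Suc_ex by blast
  have "(\<Sum>\<pi>\<in>RS n. s ^ perm_iasc n \<pi> * t ^ perm_asc n \<pi>) =
      (\<Sum>\<pi>\<in>RS n. s ^ word_iasc n (perm_word n \<pi>) * t ^ word_asc (perm_word n \<pi>))"
  proof (rule sum.cong[OF refl])
    fix \<pi> assume "\<pi> \<in> RS n"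
    then have p: "\<pi> permutes {1..n}" by (simp add: RS_def)
    show "s ^ perm_iasc n \<pi> * t ^ perm_asc n \<pi> =
        s ^ word_iasc n (perm_word n \<pi>) * t ^ word_asc (perm_word n \<pi>)"
      unfolding perm_iasc_def word_asc_perm_word word_iasc_perm_word[OF p]
        perm_asc_eq_card[OF permutes_inj_on[OF p]]
        perm_asc_eq_card[OF permutes_inj_on[OF permutes_inv[OF p]]] ..
  qed
  also have "\<dots> = (\<Sum>w\<in>simsun_words n. s ^ word_iasc n w * t ^ word_asc w)"
    by (rule sum.reindex_bij_betw[OF perm_word_bij])
  \<comment> \<open>The word \<open>[1]\<close> has a gap in front that adds no ascent and a gap at
    the end that adds one, with the mark between them.\<close>
  also have "\<dots> = growth s t k [False] [True]"
  proof -
    have "w = [1]" if "distinct w" "set w = {1}" for w :: "nat list"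
    proof -
      have "length w = 1" using that distinct_card[of w] by simp
      then obtain a where "w = [a]" by (auto simp: length_Suc_conv)
      then show ?thesis using that by simp
    qed
    then have "simsun_words 1 = {[1]}"
      by (auto simp: simsun_words_def no_double_descent_Cons)
    then show ?thesis
      unfolding n using simsun_words_sum_growth[of 1 s k t]
      by (simp add: word_iasc_def marked_growth_def Let_def)
  qed
  also have "\<dots> = (\<Sum>e\<in>inv_seqs_000 n. s ^ seq_asc n e * t ^ seq_dist n e)"
  proof -
    \<comment> \<open>The sequence (0) gives the same marked word: 0 has been taken once and 1 is
      still new.\<close>
    have "inv_seqs_000 1 = {\<lambda>i\<in>{1}. 0}"
      by (auto simp: inv_seqs_000_def inv_seqs_def PiE_iff extensional_def fun_eq_iff)
    then show ?thesis
      unfolding n using inv_seqs_000_sum_growth[of 1 s k t]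
      by (simp add: seq_asc_def seq_dist_def value_word_def usable_def cong: conj_cong)
  qed
  finally show ?thesis .
qed

end
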